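(* Let $X$ and $Y$ be locally compact Polish spaces with their Borel $\sigma$-algebras, and let $(\mathcal{F}_X,\mathcal{M}_X)$ and $(\mathcal{F}_Y,\mathcal{M}_Y)$ be given either both by the continuous setting or both by the measurable setting. Then linear weakly continuous transfunctions $\Phi:\mathcal{M}_X\to\mathcal{M}_Y$ can be approximated by simple transfunctions with respect to weak convergence; that is, simple transfunctions form a dense subset of linear weakly continuous transfunctions with respect to weak convergence.
   Context: Continuous setting: $\mathcal{F}_X=\mathcal{C}_b(X)$ (bounded continuous real functions on $X$) and $\mathcal{M}_X=\mathcal{M}_{fr}(X)$ (all finite, hence regular, signed Borel measures on $X$); similarly for $Y$. Measurable setting: finite positive Borel measures $\mu$ on $X$ and $\nu$ on $Y$ are fixed, $\mathcal{F}_X=\mathcal{L}^\infty(X,\mu)$ and $\mathcal{M}_X=\mathcal{M}^\infty_\mu=\{f\mu:f\in\mathcal{L}^\infty(X,\mu)\}$, where $f\mu$ is the signed measure $A\mapsto\int_A f\,d\mu$; similarly $\mathcal{F}_Y=\mathcal{L}^\infty(Y,\nu)$ and $\mathcal{M}_Y=\mathcal{M}^\infty_\nu$. A transfunction is a function $\Phi:\mathcal{M}_X\to\mathcal{M}_Y$. Write $\langle f,\lambda\rangle:=\int_X f\,d\lambda$. A transfunction $\Phi$ is simple if there are finitely many $f_1,\dots,f_m\in\mathcal{F}_X$ and $\rho_1,\dots,\rho_m\in\mathcal{M}_Y$ with $\Phi\lambda=\sum_{i=1}^m\langle f_i,\lambda\rangle\rho_i$ for all $\lambda\in\mathcal{M}_X$.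 In both settings, weak convergence of measures $\lambda_n\xrightarrow{w}\lambda$ means $\int f\,d\lambda_n\to\int f\,d\lambda$ for every bounded continuous real function $f$ on the space. $\Phi$ is weakly continuous if $\lambda_n\xrightarrow{w}\lambda$ in $\mathcal{M}_X$ implies $\Phi\lambda_n\xrightarrow{w}\Phi\lambda$ in $\mathcal{M}_Y$. The source does not separately define weak convergence of transfunctions; in its proof, the approximation of $\Phi$ by simple transfunctions $\Phi_n$ is understood as $\Phi_n\lambda\xrightarrow{w}\Phi\lambda$ for every $\lambda\in\mathcal{M}_X$.
   Formalization: In the measurable setting simple transfunctions need not be weakly continuous, so "dense subset" is read there as density of those simple transfunctions that are linear and weakly continuous; the inclusion of all simple ones is claimed only in the continuous setting. *)

theory Defs
  imports "HOL-Analysis.Analysis"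
begin

section \<open>Finite signed Borel measures\<close>

text \<open>
  A finite signed Borel measure is represented by its set function, which is fixed to be 0
  off the Borel sets so that equality of set functions is equality of signed measures.
  Signed measures are added and scaled pointwise.
\<close>

type_synonym 'a signed_measure = "'a set \<Rightarrow> real"

definition finite_signed_measures :: "('a::topological_space) signed_measure set" where
  "finite_signed_measures =
    {l. l {} = 0 \<and>
        (\<forall>A. range A \<subseteq> sets borel \<longrightarrow> disjoint_family A \<longrightarrow>
           (\<lambda>i::nat. l (A i)) sums l (\<Union>i. A i)) \<and>
        (\<forall>A. A \<notin> sets borel \<longrightarrow> l A = 0)}"

text \<open>
  The Jordan decomposition: the positive part maps \<open>A\<close> to the supremum of \<open>l B\<close> over Borel
  \<open>B \<subseteq> A\<close> (the function \<open>ennreal\<close> sends negative values to \<open>0\<close>, which is the value at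
  \<open>B = {}\<close>, so it does not change the supremum).
\<close>

definition positive_part :: "('a::topological_space) signed_measure \<Rightarrow> 'a measure" where
  "positive_part l =
    measure_of UNIV (sets borel) (\<lambda>A. SUP B \<in> {B \<in> sets borel. B \<subseteq> A}. ennreal (l B))"

definition negative_part :: "('a::topological_space) signed_measure \<Rightarrow> 'a measure" where
  "negative_part l = positive_part (\<lambda>A. - l A)"

definition pairing :: "('a::topological_space \<Rightarrow> real) \<Rightarrow> 'a signed_measure \<Rightarrow> real" where
  "pairing f l = (LINT x|positive_part l. f x) - (LINT x|negative_part l. f x)"

definition weak_conv ::
    "(nat \<Rightarrow> ('a::topological_space) signed_measure) \<Rightarrow> 'a signed_measure \<Rightarrow> bool" where
  "weak_conv ls l \<longleftrightarrow> (\<forall>f \<in> bcontfun. (\<lambda>n. pairing f (ls n)) \<longlonglongrightarrow> pairing f l)"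


section \<open>The continuous and the measurable setting\<close>

definition continuous_setting ::
    "('a::topological_space \<Rightarrow> real) set \<Rightarrow> 'a signed_measure set \<Rightarrow> bool" where
  "continuous_setting F M \<longleftrightarrow> F = bcontfun \<and> M = finite_signed_measures"

text \<open>
  Members of \<open>L_infinity \<mu>\<close> are functions, not classes modulo \<open>\<mu>\<close>-null sets; both \<open>f\<mu>\<close> and the
  pairing with a measure \<open>g\<mu>\<close> depend on the class only.
\<close>

definition L_infinity :: "'a measure \<Rightarrow> ('a \<Rightarrow> real) set" where
  "L_infinity \<mu> = {f \<in> borel_measurable \<mu>. \<exists>C. AE x in \<mu>. \<bar>f x\<bar> \<le> C}"

definition density_signed ::
    "('a::topological_space) measure \<Rightarrow> ('a \<Rightarrow> real) \<Rightarrow> 'a signed_measure" where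
  "density_signed \<mu> f = (\<lambda>A. if A \<in> sets borel then (LINT x:A|\<mu>. f x) else 0)"

definition measurable_setting ::
    "('a::topological_space \<Rightarrow> real) set \<Rightarrow> 'a signed_measure set \<Rightarrow> bool" where
  "measurable_setting F M \<longleftrightarrow>
    (\<exists>\<mu>. sets \<mu> = sets borel \<and> finite_measure \<mu> \<and>
         F = L_infinity \<mu> \<and> M = density_signed \<mu> ` L_infinity \<mu>)"


section \<open>Transfunctions\<close>

text \<open>
  A transfunction is a function from \<open>MX\<close> to \<open>MY\<close>; its values outside \<open>MX\<close> are irrelevant and
  every notion below only looks at \<open>MX\<close>.
\<close>

type_synonym ('a, 'b) transfunction = "'a signed_measure \<Rightarrow> 'b signed_measure"

definition linear_transfunction ::
    "'a signed_measure set \<Rightarrow> ('a, 'b) transfunction \<Rightarrow> bool" where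
  "linear_transfunction MX \<Phi> \<longleftrightarrow>
    (\<forall>k \<in> MX. \<forall>l \<in> MX. \<forall>a b. \<Phi> (\<lambda>A. a * k A + b * l A) = (\<lambda>B. a * \<Phi> k B + b * \<Phi> l B))"

definition weakly_continuous ::
    "('a::topological_space) signed_measure set \<Rightarrow> ('a, 'b::topological_space) transfunction \<Rightarrow> bool"
  where
  "weakly_continuous MX \<Phi> \<longleftrightarrow>
    (\<forall>ls. \<forall>l \<in> MX. (\<forall>n. ls n \<in> MX) \<longrightarrow> weak_conv ls l \<longrightarrow> weak_conv (\<lambda>n. \<Phi> (ls n)) (\<Phi> l))"

definition linear_weakly_continuous_transfunctions ::
    "('a::topological_space) signed_measure set \<Rightarrow> ('b::topological_space) signed_measure set \<Rightarrow>
     ('a, 'b) transfunction set" where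
  "linear_weakly_continuous_transfunctions MX MY =
    {\<Phi> \<in> MX \<rightarrow> MY. linear_transfunction MX \<Phi> \<and> weakly_continuous MX \<Phi>}"

definition simple_transfunctions ::
    "('a::topological_space \<Rightarrow> real) set \<Rightarrow> 'a signed_measure set \<Rightarrow> 'b signed_measure set \<Rightarrow>
     ('a, 'b) transfunction set" where
  "simple_transfunctions FX MX MY =
    {\<Phi> \<in> MX \<rightarrow> MY. \<exists>(m::nat) f \<rho>. (\<forall>i<m. f i \<in> FX \<and> \<rho> i \<in> MY) \<and>
       (\<forall>l \<in> MX. \<Phi> l = (\<lambda>B. \<Sum>i<m. pairing (f i) l * \<rho> i B))}"

definition transfunction_weak_conv ::
    "('a::topological_space) signed_measure set \<Rightarrow>
     (nat \<Rightarrow> ('a, 'b::topological_space) transfunction) \<Rightarrow> ('a, 'b) transfunction \<Rightarrow> bool" where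
  "transfunction_weak_conv MX \<Phi>s \<Phi> \<longleftrightarrow> (\<forall>l \<in> MX. weak_conv (\<lambda>n. \<Phi>s n l) (\<Phi> l))"

end

theory Submission
  imports Defs "HOL-Probability.Giry_Monad"
begin

text \<open>
  The identity on measures is a pointwise weak limit of simple transfunctions
  \<open>P\<^sub>n l = (\<Sum>i\<le>n. pairing (w\<^sub>n\<^sub>i) l * \<kappa>\<^sub>n\<^sub>i)\<close>, where \<open>w\<^sub>n\<^sub>i\<close> is a continuous partition of unity and
  \<open>\<kappa>\<^sub>n\<^sub>i\<close> is a probability measure near \<open>d i\<close>: a Dirac measure in the continuous setting, the
  normalised restriction of \<open>\<mu>\<close> to a small ball in the measurable one. For linear, weakly continuous
  \<open>\<Phi>\<close> the transfunctions \<open>\<Phi> \<circ> P\<^sub>n\<close> are simple and converge to \<open>\<Phi>\<close>. The supports of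
  the \<open>w\<^sub>n\<^sub>i\<close> shrink only pointwise: \<open>w\<^sub>n\<^sub>i x \<noteq> 0\<close> forces \<open>d i\<close> to be within \<open>1/(n+1)\<close> of being a
  nearest point to \<open>x\<close> among \<open>d 0, \<dots>, d n\<close>. This is all that dominated convergence needs.
\<close>

section \<open>The Jordan decomposition\<close>

text \<open>Since \<open>ennreal\<close> truncates negative reals to 0, it is only subadditive on
  signed values. This is the direction needed to bound \<open>l B\<close> by the sum of the positive
  parts of the pieces of \<open>B\<close>.\<close>

lemma ennreal_add_le: "ennreal (a + b) \<le> ennreal a + ennreal b"
proof -
  have "ennreal (a + b) \<le> ennreal (max 0 a + max 0 b)"
    by (intro ennreal_leI) simp
  also have "\<dots> = ennreal a + ennreal b"
    by (simp add: max_def ennreal_neg)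
  finally show ?thesis .
qed

lemma ennreal_sum_le: "ennreal (\<Sum>i<n. f i) \<le> (\<Sum>i<n. ennreal (f i))" for n :: nat
proof (induction n)
  case (Suc n)
  then show ?case
    using ennreal_add_le[of "\<Sum>i<n. f i" "f n"] by (auto intro: order_trans add_right_mono)
qed simp

lemma sets_positive_part [simp]: "sets (positive_part l) = sets borel"
  using sets.sigma_sets_eq[of borel] by (simp add: positive_part_def)

lemma space_positive_part [simp]: "space (positive_part l) = UNIV"
  by (simp add: positive_part_def)

lemma sets_negative_part [simp]: "sets (negative_part l) = sets borel"
  by (simp add: negative_part_def)

context
  fixes l :: "'a::topological_space signed_measure"
  assumes l: "l \<in> finite_signed_measures"
begin

lemma signed_measure_empty: "l {} = 0"
  using l by (simp add: finite_signed_measures_def)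

lemma signed_measure_not_borel: "A \<notin> sets borel \<Longrightarrow> l A = 0"
  using l by (simp add: finite_signed_measures_def)

lemma signed_measure_sums:
  fixes A :: "nat \<Rightarrow> 'a set"
  shows "range A \<subseteq> sets borel \<Longrightarrow> disjoint_family A \<Longrightarrow> (\<lambda>i. l (A i)) sums l (\<Union>i. A i)"
  using l by (simp add: finite_signed_measures_def)

lemma signed_measure_Un:
  assumes "A \<in> sets borel" "B \<in> sets borel" "A \<inter> B = {}"
  shows "l (A \<union> B) = l A + l B"
proof -
  have "(\<lambda>n. l (binaryset A B n)) sums l (\<Union>i. binaryset A B i)"
    using assms by (intro signed_measure_sums) (auto simp: binaryset_def disjoint_family_on_def)
  moreover have "(\<lambda>n. l (binaryset A B n)) sums (l A + l B)"
    by (rule binaryset_sums) (rule signed_measure_empty)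
  ultimately show ?thesis
    by (simp add: UN_binaryset_eq sums_unique2)
qed

lemma signed_measure_Diff:
  assumes "A \<in> sets borel" "B \<in> sets borel" "B \<subseteq> A"
  shows "l (A - B) = l A - l B"
proof -
  have "l ((A - B) \<union> B) = l (A - B) + l B"
    using assms by (intro signed_measure_Un) auto
  moreover have "(A - B) \<union> B = A"
    using assms by auto
  ultimately show ?thesis
    by simp
qed

lemma uminus_signed_measure: "(\<lambda>A. - l A) \<in> finite_signed_measures"
  using l by (auto simp: finite_signed_measures_def intro: sums_minus)

text \<open>\<open>measure_of\<close> takes the prescribed values only if these are countably
  additive. The supremum is superadditive because Borel subsets of disjoint sets have a disjoint
  union as a competitor, and it is countably subadditive because a Borel subset \<open>B\<close> of
  the union is cut into the pieces \<open>B \<inter> A i\<close>.\<close>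

lemma emeasure_positive_part:
  assumes "A \<in> sets borel"
  shows "emeasure (positive_part l) A = (SUP B \<in> {B \<in> sets borel. B \<subseteq> A}. ennreal (l B))"
proof -
  define p where "p A = (SUP B \<in> {B \<in> sets borel. B \<subseteq> A}. ennreal (l B))" for A
  have upper: "ennreal (l B) \<le> p A" if "B \<in> sets borel" "B \<subseteq> A" for A B
    unfolding p_def using that by (intro SUP_upper) auto
  have p_mono: "p A \<le> p B" if "A \<subseteq> B" for A B
    unfolding p_def using that by (intro SUP_subset_mono) auto
  have p_empty: "p {} = 0"
    by (simp add: p_def signed_measure_empty cong: conj_cong)
  have p_Un: "p A + p B \<le> p (A \<union> B)" if "A \<inter> B = {}" for A B
  proof -
    have ne: "{C \<in> sets borel. C \<subseteq> D} \<noteq> {}" for D :: "'a set"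
      by (auto intro: exI[of _ "{}"])
    have *: "ennreal (l C) + ennreal (l D) \<le> p (A \<union> B)"
      if "C \<in> sets borel" "C \<subseteq> A" "D \<in> sets borel" "D \<subseteq> B" for C D
    proof (cases "0 \<le> l C \<and> 0 \<le> l D")
      case True
      have "C \<inter> D = {}"
        using that \<open>A \<inter> B = {}\<close> by auto
      then have "ennreal (l C) + ennreal (l D) = ennreal (l (C \<union> D))"
        using True that by (simp add: signed_measure_Un)
      also have "\<dots> \<le> p (A \<union> B)"
        using that by (intro upper) auto
      finally show ?thesis .
    next
      \<comment> \<open>If one of the two values is negative, its \<open>ennreal\<close> is 0, and
        the other set alone is a competitor for \<open>A \<union> B\<close>.\<close>
      case False
      then show ?thesis
        using upper[of C "A \<union> B"] upper[of D "A \<union> B"] that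
        by (auto simp: not_le ennreal_neg le_supI1 le_supI2 order.strict_implies_order)
    qed
    have "p A + p B = (SUP C \<in> {C \<in> sets borel. C \<subseteq> A}. ennreal (l C) + p B)"
      by (simp add: p_def ennreal_SUP_add_left[OF ne])
    also have "\<dots> \<le> p (A \<union> B)"
    proof (rule SUP_least)
      fix C :: "'a set" assume C: "C \<in> {C \<in> sets borel. C \<subseteq> A}"
      have "ennreal (l C) + p B = (SUP D \<in> {D \<in> sets borel. D \<subseteq> B}. ennreal (l C) + ennreal (l D))"
        by (simp add: p_def ennreal_SUP_add_right[OF ne])
      also have "\<dots> \<le> p (A \<union> B)"
        using C * by (intro SUP_least) auto
      finally show "ennreal (l C) + p B \<le> p (A \<union> B)" .
    qed
    finally show ?thesis .
  qed
  have "countably_additive (sets borel) p"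
  proof (rule countably_additiveI)
    fix A :: "nat \<Rightarrow> 'a set"
    assume A: "range A \<subseteq> sets borel" "disjoint_family A"
    have "(\<Sum>i<n. p (A i)) \<le> p (\<Union>i<n. A i)" for n
    proof (induction n)
      case (Suc n)
      have "A n \<inter> A i = {}" if "i < n" for i
        using disjoint_family_onD[OF A(2), of n i] that by simp
      then have disj: "A n \<inter> (\<Union>i<n. A i) = {}"
        by blast
      have "(\<Sum>i<Suc n. p (A i)) = p (A n) + (\<Sum>i<n. p (A i))"
        by (simp add: add.commute)
      also have "\<dots> \<le> p (A n) + p (\<Union>i<n. A i)"
        using Suc by (rule add_left_mono)
      also have "\<dots> \<le> p (A n \<union> (\<Union>i<n. A i))"
        by (rule p_Un[OF disj])
      finally show ?case
        by (simp add: lessThan_Suc)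
    qed (simp add: p_empty)
    also have "p (\<Union>i<n. A i) \<le> p (\<Union>i. A i)" for n
      by (intro p_mono) auto
    finally have le: "(\<Sum>i. p (A i)) \<le> p (\<Union>i. A i)"
      by (intro suminf_le_const summableI) auto
    have "p (\<Union>i. A i) \<le> (\<Sum>i. p (A i))"
      unfolding p_def[of "\<Union>i. A i"]
    proof (rule SUP_least)
      fix B :: "'a set" assume B: "B \<in> {B \<in> sets borel. B \<subseteq> (\<Union>i. A i)}"
      have "(\<lambda>i. l (B \<inter> A i)) sums l (\<Union>i. B \<inter> A i)"
        using A B by (intro signed_measure_sums) (auto simp: disjoint_family_on_def)
      moreover have "(\<Union>i. B \<inter> A i) = B"
        using B by auto
      ultimately have "(\<lambda>n. ennreal (\<Sum>i<n. l (B \<inter> A i))) \<longlonglongrightarrow> ennreal (l B)"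
        by (auto simp: sums_def intro: tendsto_ennrealI)
      moreover have "ennreal (\<Sum>i<n. l (B \<inter> A i)) \<le> (\<Sum>i. p (A i))" for n
      proof -
        have "ennreal (\<Sum>i<n. l (B \<inter> A i)) \<le> (\<Sum>i<n. ennreal (l (B \<inter> A i)))"
          by (rule ennreal_sum_le)
        also have "\<dots> \<le> (\<Sum>i<n. p (A i))"
          using A B by (intro sum_mono upper) auto
        also have "\<dots> \<le> (\<Sum>i. p (A i))"
          by (intro sum_le_suminf) auto
        finally show ?thesis .
      qed
      ultimately show "ennreal (l B) \<le> (\<Sum>i. p (A i))"
        by (auto intro!: LIMSEQ_le_const2[of "\<lambda>n. ennreal (\<Sum>i<n. l (B \<inter> A i))"])
    qed
    with le show "(\<Sum>i. p (A i)) = p (\<Union>i. A i)"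
      by (rule antisym)
  qed
  moreover have "positive (sets borel) p"
    by (simp add: positive_def p_empty)
  moreover have "sigma_algebra UNIV (sets (borel :: 'a measure))"
    using sets.sigma_algebra_axioms[of "borel :: 'a measure"] by simp
  moreover have "positive_part l = measure_of UNIV (sets borel) p"
    by (simp add: positive_part_def p_def [abs_def])
  ultimately show ?thesis
    using assms by (simp add: emeasure_measure_of_sigma p_def)
qed

text \<open>
  If the positive part had infinite mass, it would have infinite mass on a decreasing sequence
  of sets whose successive differences all have signed measure larger than 1 in absolute value.
\<close>

lemma finite_measure_positive_part: "finite_measure (positive_part l)"
proof (rule finite_measureI, rule notI)
  let ?p = "emeasure (positive_part l)"
  assume inf: "?p (space (positive_part l)) = \<infinity>"
  let ?P = "\<lambda>(_::nat) E. E \<in> sets borel \<and> ?p E = \<infinity>"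
  let ?Q = "\<lambda>(_::nat) E E'. E' \<subseteq> E \<and> 1 < \<bar>l (E - E')\<bar>"
  have "\<exists>E'. ?P (Suc n) E' \<and> ?Q n E E'" if "?P n E" for n E
  proof -
    have E: "E \<in> sets borel" and "?p E = \<infinity>"
      using that by auto
    \<comment> \<open>The threshold \<open>1 + \<bar>l E\<bar>\<close> makes both \<open>l B\<close>
      and \<open>l (E - B) = l E - l B\<close> larger than 1 in absolute value. So either of
      \<open>B\<close> and \<open>E - B\<close> may serve as the next set, and the one of infinite
      mass is taken.\<close>
    then have "ennreal (1 + \<bar>l E\<bar>) < (SUP B \<in> {B \<in> sets borel. B \<subseteq> E}. ennreal (l B))"
      by (simp flip: emeasure_positive_part)
    then obtain B where B: "B \<in> sets borel" "B \<subseteq> E" and "ennreal (1 + \<bar>l E\<bar>) < ennreal (l B)"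
      by (auto simp: less_SUP_iff)
    then have lB: "1 + \<bar>l E\<bar> < l B"
      by (simp add: ennreal_less_iff del: ennreal_plus)
    have "?p E = ?p B + ?p (E - B)"
      using plus_emeasure[of B "positive_part l" "E - B"] B E by (simp add: Un_absorb1)
    with \<open>?p E = \<infinity>\<close> consider "?p B = \<infinity>" | "?p (E - B) = \<infinity>"
      by auto
    then show ?thesis
    proof cases
      case 1
      then show ?thesis
        using B E lB by (intro exI[of _ B]) (auto simp: signed_measure_Diff)
    next
      case 2
      then show ?thesis
        using B E lB by (intro exI[of _ "E - B"]) (auto simp: double_diff)
    qed
  qed
  moreover have "?P 0 UNIV"
    using inf by simp
  ultimately obtain E where E: "\<And>n. ?P n (E n)" "\<And>n. ?Q n (E n) (E (Suc n))"
    using dependent_nat_choice[of ?P ?Q] by blast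
  have "decseq E"
    using E by (intro decseq_SucI) auto
  then have "disjoint_family (\<lambda>n. E n - E (Suc n))"
    unfolding disjoint_family_on_def decseq_def
    by (metis (no_types, lifting) Diff_disjoint Diff_iff Suc_leI disjoint_iff linorder_neqE_nat subsetD)
  \<comment> \<open>Countable additivity makes the series of these values converge, so its terms
    cannot all exceed 1 in absolute value.\<close>
  then have "(\<lambda>n. l (E n - E (Suc n))) \<longlonglongrightarrow> 0"
    using E by (intro summable_LIMSEQ_zero sums_summable[OF signed_measure_sums]) auto
  then have "\<forall>\<^sub>F n in sequentially. \<bar>l (E n - E (Suc n))\<bar> < 1"
    using tendstoD[of "\<lambda>n. l (E n - E (Suc n))" 0 sequentially 1] by (simp add: dist_real_def)
  then obtain n where "\<bar>l (E n - E (Suc n))\<bar> < 1"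
    by (auto simp: eventually_sequentially)
  then show False
    using E(2)[of n] by simp
qed

end

lemma finite_measure_negative_part: "l \<in> finite_signed_measures \<Longrightarrow> finite_measure (negative_part l)"
  by (simp add: negative_part_def finite_measure_positive_part uminus_signed_measure)

text \<open>For Borel \<open>B \<subseteq> A\<close>, the value \<open>l B = l A - l (A - B)\<close>
  is at most \<open>l A\<close> plus the negative part of \<open>A\<close>. The supremum over
  \<open>B\<close> gives one inequality; the same argument for \<open>- l\<close> gives the
  other.\<close>

lemma Jordan_decomposition:
  assumes l: "l \<in> finite_signed_measures"
  shows "l A = measure (positive_part l) A - measure (negative_part l) A"
proof (cases "A \<in> sets borel")
  case A: True
  interpret P: finite_measure "positive_part l"
    by (rule finite_measure_positive_part[OF l])
  interpret N: finite_measure "negative_part l"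
    by (rule finite_measure_negative_part[OF l])
  let ?p = "measure (positive_part l) A" and ?n = "measure (negative_part l) A"
  have p: "l B \<le> ?p" if "B \<in> sets borel" "B \<subseteq> A" for B
  proof -
    have "ennreal (l B) \<le> emeasure (positive_part l) A"
      unfolding emeasure_positive_part[OF l A] using that by (intro SUP_upper) auto
    then show ?thesis
      by (simp add: P.emeasure_eq_measure ennreal_le_iff)
  qed
  have n: "- l B \<le> ?n" if "B \<in> sets borel" "B \<subseteq> A" for B
  proof -
    have "ennreal (- l B) \<le> emeasure (negative_part l) A"
      unfolding negative_part_def emeasure_positive_part[OF uminus_signed_measure[OF l] A]
      using that by (intro SUP_upper) auto
    then show ?thesis
      by (simp add: N.emeasure_eq_measure ennreal_le_iff)
  qed
  have "emeasure (positive_part l) A \<le> ennreal (l A + ?n)"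
    unfolding emeasure_positive_part[OF l A]
    proof (intro SUP_least ennreal_leI)
    fix B assume "B \<in> {B \<in> sets borel. B \<subseteq> A}"
    then show "l B \<le> l A + ?n"
      using n[of "A - B"] A by (auto simp: signed_measure_Diff[OF l])
  qed
  moreover have "0 \<le> l A + ?n"
    using n[OF A] by simp
  ultimately have 1: "?p \<le> l A + ?n"
    by (simp add: P.emeasure_eq_measure ennreal_le_iff)
  have "emeasure (negative_part l) A \<le> ennreal (?p - l A)"
    unfolding negative_part_def emeasure_positive_part[OF uminus_signed_measure[OF l] A]
    proof (intro SUP_least ennreal_leI)
    fix B assume "B \<in> {B \<in> sets borel. B \<subseteq> A}"
    then show "- l B \<le> ?p - l A"
      using p[of "A - B"] A by (auto simp: signed_measure_Diff[OF l])
  qed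
  moreover have "0 \<le> ?p - l A"
    using p[OF A] by simp
  ultimately have "?n \<le> ?p - l A"
    by (simp add: N.emeasure_eq_measure ennreal_le_iff)
  with 1 show ?thesis
    by simp
qed (simp add: l signed_measure_not_borel measure_notin_sets)

section \<open>Linear combinations, and positive measures as signed measures\<close>

lemma linear_combination_signed_measure:
  assumes "k \<in> finite_signed_measures" "l \<in> finite_signed_measures"
  shows "(\<lambda>A. a * k A + b * l A) \<in> finite_signed_measures"
  using assms by (auto simp: finite_signed_measures_def intro!: sums_add sums_mult)

text \<open>\<open>measure m\<close> is 0 off the sets of \<open>m\<close>, which agrees with the
  convention for signed measures off the Borel sets.\<close>

lemma measure_signed_measure:
  assumes "finite_measure m" "sets m = sets borel"
  shows "measure m \<in> finite_signed_measures"
proof -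
  interpret finite_measure m by fact
  show ?thesis
    using assms(2) by (auto simp: finite_signed_measures_def measure_notin_sets intro: finite_measure_UNION)
qed

section \<open>The pairing\<close>

lemma pairing_cmult: "pairing (\<lambda>x. c * f x) l = c * pairing f l"
  by (simp add: pairing_def right_diff_distrib)

lemma integrable_bounded_borel:
  fixes f :: "'a::topological_space \<Rightarrow> real"
  assumes "finite_measure m" "sets m = sets borel" "f \<in> borel_measurable borel" "\<And>x. \<bar>f x\<bar> \<le> C"
  shows "integrable m f"
proof -
  interpret finite_measure m by fact
  have "f \<in> borel_measurable m"
    using assms(2,3) by (simp cong: measurable_cong_sets)
  then show ?thesis
    using assms(4) by (intro integrable_const_bound[where B = C]) auto
qed

section \<open>Pairing with a positive measure\<close>

text \<open>By monotonicity of \<open>m\<close>, the supremum over Borel subsets of \<open>A\<close>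
  is attained at \<open>A\<close> itself.\<close>

lemma positive_part_measure:
  assumes "finite_measure m" "sets m = sets borel"
  shows "positive_part (measure m) = m"
proof (rule measure_eqI)
  interpret finite_measure m by fact
  have m: "measure m \<in> finite_signed_measures"
    using assms by (rule measure_signed_measure)
  show "sets (positive_part (measure m)) = sets m"
    using assms(2) m by simp
  fix A assume "A \<in> sets (positive_part (measure m))"
  then have A: "A \<in> sets borel"
    using m by simp
  have "(SUP B \<in> {B \<in> sets borel. B \<subseteq> A}. emeasure m B) = emeasure m A"
    using A assms(2) by (intro antisym SUP_least emeasure_mono SUP_upper) auto
  then show "emeasure (positive_part (measure m)) A = emeasure m A"
    by (simp add: emeasure_positive_part[OF m A] emeasure_eq_measure)
qed

lemma negative_part_measure:
  fixes m :: "'a::topological_space measure"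
  assumes "finite_measure m" "sets m = sets borel"
  shows "emeasure (negative_part (measure m)) UNIV = 0"
proof -
  have m: "(\<lambda>A. - measure m A) \<in> finite_signed_measures"
    using assms by (intro uminus_signed_measure measure_signed_measure)
  have "(SUP B \<in> {B \<in> sets borel. B \<subseteq> UNIV}. ennreal (- measure m B)) = 0"
    by (auto simp: ennreal_neg bot_ennreal[symmetric] intro!: SUP_bot_conv(1)[THEN iffD2])
  then show ?thesis
    unfolding negative_part_def by (subst emeasure_positive_part[OF m]) auto
qed

text \<open>The pairing goes through the Jordan decomposition, so the plain integral has to be
  recovered: the positive part is \<open>m\<close>, and the integral over the negative part vanishes
  because that part is null.\<close>

lemma pairing_measure:
  fixes m :: "'a::topological_space measure"
  assumes "finite_measure m" "sets m = sets borel"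
  shows "pairing f (measure m) = (LINT x|m. f x)"
proof -
  have "AE x in negative_part (measure m). f x = 0"
    using negative_part_measure[OF assms] measure_signed_measure[OF assms]
    by (intro AE_I[where N = UNIV]) (auto simp: negative_part_def uminus_signed_measure)
  then have "(LINT x|negative_part (measure m). f x) = 0"
    by (rule integral_eq_zero_AE)
  then show ?thesis
    by (simp add: pairing_def positive_part_measure[OF assms])
qed

section \<open>Linearity and continuity of the pairing in the integrand\<close>

context
  fixes l :: "'a::topological_space signed_measure"
  assumes l: "l \<in> finite_signed_measures"
begin

lemma integrable_Jordan:
  assumes "f \<in> borel_measurable borel" "\<And>x. \<bar>f x\<bar> \<le> (C::real)"
  shows "integrable (positive_part l) f" "integrable (negative_part l) f"
  using integrable_bounded_borel[OF finite_measure_positive_part[OF l] _ assms]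
    integrable_bounded_borel[OF finite_measure_negative_part[OF l] _ assms] l
  by simp_all

text \<open>This is the Jordan decomposition in terms of the pairing. It is the base case of the
  induction that proves linearity in the measure.\<close>

lemma pairing_indicator:
  assumes "A \<in> sets borel"
  shows "pairing (indicator A) l = l A"
  using assms l
  by (simp add: pairing_def Jordan_decomposition[OF l, of A] negative_part_def uminus_signed_measure)

lemma pairing_add:
  assumes "f \<in> borel_measurable borel" "\<And>x. \<bar>f x\<bar> \<le> C" "g \<in> borel_measurable borel" "\<And>x. \<bar>g x\<bar> \<le> D"
  shows "pairing (\<lambda>x. f x + g x) l = pairing f l + pairing g l"
  using integrable_Jordan[OF assms(1,2)] integrable_Jordan[OF assms(3,4)] by (simp add: pairing_def)

lemma pairing_sum:
  assumes "finite I"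
    and "\<And>i. i \<in> I \<Longrightarrow> f i \<in> borel_measurable borel" "\<And>i x. i \<in> I \<Longrightarrow> \<bar>f i x\<bar> \<le> C i"
  shows "pairing (\<lambda>x. \<Sum>i\<in>I. f i x) l = (\<Sum>i\<in>I. pairing (f i) l)"
proof -
  have "integrable (positive_part l) (f i)" "integrable (negative_part l) (f i)" if "i \<in> I" for i
    using integrable_Jordan[OF assms(2)[OF that] assms(3)[OF that]] by auto
  then show ?thesis
    by (simp add: pairing_def sum_subtractf)
qed

lemma pairing_dominated_convergence:
  assumes "\<And>n. u n \<in> borel_measurable borel" "f \<in> borel_measurable borel"
    and "\<And>n x. \<bar>u n x\<bar> \<le> C" "\<And>x. (\<lambda>n. u n x) \<longlonglongrightarrow> f x"
  shows "(\<lambda>n. pairing (u n) l) \<longlonglongrightarrow> pairing f l"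
proof -
  have lim: "(\<lambda>n. integral\<^sup>L m (u n)) \<longlonglongrightarrow> integral\<^sup>L m f"
    if "finite_measure m" "sets m = sets borel" for m :: "'a measure"
  proof (rule integral_dominated_convergence)
    show "integrable m (\<lambda>_. C)"
      using that(1) by (simp add: finite_measure.integrable_const)
  qed (use assms that(2) in \<open>auto cong: measurable_cong_sets\<close>)
  show ?thesis
    unfolding pairing_def using l
    by (intro tendsto_diff lim finite_measure_positive_part finite_measure_negative_part) auto
qed

end

section \<open>Linearity of the pairing in the measure\<close>

text \<open>The positive part of a sum is in general not the sum of the positive parts, so linearity
  in the measure cannot be read off the definition. It holds for indicators and passes to scaled
  functions, sums and monotone limits.\<close>

lemma pairing_sum_signed_measure:
  fixes l :: "'a::topological_space signed_measure"
  assumes l: "l \<in> finite_signed_measures" and I: "finite I"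
    and k: "\<And>i. i \<in> I \<Longrightarrow> k i \<in> finite_signed_measures"
    and eq: "\<And>A. A \<in> sets borel \<Longrightarrow> l A = (\<Sum>i\<in>I. c i * k i A)"
    and f: "f \<in> borel_measurable borel" "\<And>x. \<bar>f x\<bar> \<le> C"
  shows "pairing f l = (\<Sum>i\<in>I. c i * pairing f (k i))"
proof -
  \<comment> \<open>The bound is a premise inside the predicate because the induction also runs
    through unbounded functions. Nonnegativity lets a bound on a sum or on a monotone limit pass
    down to its constituents.\<close>
  define P where "P u \<longleftrightarrow> (\<forall>C. (\<forall>x. \<bar>u x\<bar> \<le> C) \<longrightarrow> pairing u l = (\<Sum>i\<in>I. c i * pairing u (k i)))"
    for u :: "'a \<Rightarrow> real"
  have nonneg: "P u" if u: "u \<in> borel_measurable borel" "\<And>x. 0 \<le> u x" for u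
    using u
  proof (induction rule: borel_measurable_induct_real)
    case (set A)
    then show ?case
      by (simp add: P_def pairing_indicator l k eq)
  next
    case (mult u r)
    show ?case
    proof (cases "r = 0")
      \<comment> \<open>For \<open>r = 0\<close> a bound on \<open>r * u\<close> says nothing about
        \<open>u\<close>, so the induction hypothesis cannot be applied; both sides are 0.\<close>
      case True
      then show ?thesis
        by (simp add: P_def pairing_def)
    next
      case False
      have "pairing (\<lambda>x. r * u x) l = (\<Sum>i\<in>I. c i * pairing (\<lambda>x. r * u x) (k i))"
        if "\<forall>x. \<bar>r * u x\<bar> \<le> C" for C
      proof -
        have "\<forall>x. \<bar>u x\<bar> \<le> C / r"
          using that mult.hyps(1) False by (simp add: abs_mult pos_le_divide_eq mult.commute)
        then have "pairing u l = (\<Sum>i\<in>I. c i * pairing u (k i))"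
          using \<open>P u\<close> unfolding P_def by blast
        then show ?thesis
          by (simp add: pairing_cmult sum_distrib_left mult.left_commute)
      qed
      then show ?thesis
        unfolding P_def by blast
    qed
  next
    case (add u v)
    have "pairing (\<lambda>x. v x + u x) l = (\<Sum>i\<in>I. c i * pairing (\<lambda>x. v x + u x) (k i))"
      if C: "\<forall>x. \<bar>v x + u x\<bar> \<le> C" for C
    proof -
      have uC: "\<bar>u x\<bar> \<le> C" and vC: "\<bar>v x\<bar> \<le> C" for x
        using C[rule_format, of x] add.hyps(2)[of x] add.hyps(4)[of x] by auto
      have "pairing u l = (\<Sum>i\<in>I. c i * pairing u (k i))" "pairing v l = (\<Sum>i\<in>I. c i * pairing v (k i))"
        using \<open>P u\<close> \<open>P v\<close> uC vC unfolding P_def by blast+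
      moreover have "pairing (\<lambda>x. v x + u x) m = pairing v m + pairing u m"
        if "m \<in> finite_signed_measures" for m
        using that add.hyps uC vC by (intro pairing_add)
      ultimately show ?thesis
        by (simp add: l k distrib_left sum.distrib)
    qed
    then show ?case
      unfolding P_def by blast
  next
    case (seq U)
    have "pairing u l = (\<Sum>i\<in>I. c i * pairing u (k i))" if C: "\<forall>x. \<bar>u x\<bar> \<le> C" for C
    proof -
      have "U n x \<le> u x" for n x
        using seq.hyps(3,4) by (intro incseq_le) (auto simp: incseq_def le_fun_def)
      then have UC: "\<bar>U n x\<bar> \<le> C" for n x
        using C seq.hyps(2)[of n x] by (metis abs_le_D1 abs_of_nonneg order_trans)
      have lim: "(\<lambda>n. pairing (U n) m) \<longlonglongrightarrow> pairing u m" if "m \<in> finite_signed_measures" for m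
        using that seq.hyps UC u by (intro pairing_dominated_convergence) auto
      have "pairing (U n) l = (\<Sum>i\<in>I. c i * pairing (U n) (k i))" for n
        using seq.IH[of n] UC unfolding P_def by blast
      then have "(\<lambda>n. pairing (U n) l) \<longlonglongrightarrow> (\<Sum>i\<in>I. c i * pairing u (k i))"
        using k by (auto intro!: tendsto_sum tendsto_mult lim)
      with lim[OF l] show ?thesis
        by (rule LIMSEQ_unique)
    qed
    then show ?case
      unfolding P_def by blast
  qed
  have "pairing f m = pairing (\<lambda>x. max 0 (f x)) m + (-1) * pairing (\<lambda>x. max 0 (- f x)) m"
    if m: "m \<in> finite_signed_measures" for m
  proof -
    have "pairing (\<lambda>x. max 0 (f x) + (-1) * max 0 (- f x)) m
        = pairing (\<lambda>x. max 0 (f x)) m + pairing (\<lambda>x. (-1) * max 0 (- f x)) m"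
    proof (rule pairing_add[OF m])
      show "\<bar>max 0 (f x)\<bar> \<le> C" "\<bar>(-1) * max 0 (- f x)\<bar> \<le> C" for x
        using f(2)[of x] by auto
    qed (use f(1) in measurable)
    moreover have "(\<lambda>x. max 0 (f x) + (-1) * max 0 (- f x)) = f"
      by auto
    ultimately show ?thesis
      by (simp only: pairing_cmult)
  qed
  moreover have "pairing (\<lambda>x. max 0 (s * f x)) l = (\<Sum>i\<in>I. c i * pairing (\<lambda>x. max 0 (s * f x)) (k i))"
    if "\<bar>s\<bar> = 1" for s
  proof -
    have "P (\<lambda>x. max 0 (s * f x))"
      using f(1) by (intro nonneg) auto
    moreover have "\<bar>max 0 (s * f x)\<bar> \<le> C" for x
      using f(2)[of x] that abs_mult[of s "f x"] by auto
    ultimately show ?thesis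
      unfolding P_def by blast
  qed
  from this[of 1] this[of "-1"] show ?thesis
    using calculation by (simp add: l k sum_subtractf right_diff_distrib)
qed

lemma pairing_linear_combination:
  assumes "k \<in> finite_signed_measures" "l \<in> finite_signed_measures"
    and "f \<in> borel_measurable borel" "\<And>x. \<bar>f x\<bar> \<le> C"
  shows "pairing f (\<lambda>A. a * k A + b * l A) = a * pairing f k + b * pairing f l"
  \<comment> \<open>The two summands are indexed by the Booleans.\<close>
  using pairing_sum_signed_measure[OF linear_combination_signed_measure[OF assms(1,2), of a b],
      of "UNIV :: bool set" "\<lambda>i. if i then k else l" "\<lambda>i. if i then a else b", OF _ _ _ assms(3,4)] assms
  by (simp add: UNIV_bool add.commute)

section \<open>Discretization of signed measures\<close>

lemma bcontfun_bounded_borel: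
  fixes f :: "'a::topological_space \<Rightarrow> real"
  assumes "f \<in> bcontfun"
  obtains C where "f \<in> borel_measurable borel" "\<And>x. \<bar>f x\<bar> \<le> C"
  using assms that unfolding bcontfun_def bounded_iff
  by (auto intro: borel_measurable_continuous_onI)

section \<open>A continuous partition of unity following the nearest centres\<close>

text \<open>The slack \<open>1 / real (Suc n)\<close> makes the bump of a nearest centre positive;
  without it all bumps would vanish. Normalising by the sum gives \<open>weight\<close>.\<close>

definition bump :: "(nat \<Rightarrow> 'a::metric_space) \<Rightarrow> nat \<Rightarrow> nat \<Rightarrow> 'a \<Rightarrow> real" where
  "bump d n i x = max 0 (infdist x (d ` {..n}) + 1 / real (Suc n) - dist x (d i))"

definition weight :: "(nat \<Rightarrow> 'a::metric_space) \<Rightarrow> nat \<Rightarrow> nat \<Rightarrow> 'a \<Rightarrow> real" where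
  "weight d n i x = bump d n i x / (\<Sum>j\<le>n. bump d n j x)"

lemma bump_nonneg: "0 \<le> bump d n i x"
  by (simp add: bump_def)

text \<open>Some centre is closer to \<open>x\<close> than the infimum plus the slack, so its bump
  is positive. Thus the denominator in \<open>weight\<close> never vanishes, which gives both the
  total weight 1 and continuity.\<close>

lemma sum_bump_pos: "0 < (\<Sum>j\<le>n. bump d n j x)"
proof -
  have "infdist x (d ` {..n}) < infdist x (d ` {..n}) + 1 / real (Suc n)"
    by simp
  then obtain i where "i \<le> n" "dist x (d i) < infdist x (d ` {..n}) + 1 / real (Suc n)"
    by (subst (asm) infdist_notempty) (auto simp: cINF_less_iff)
  then show ?thesis
    by (intro sum_pos2[of _ i]) (auto simp: bump_def)
qed

lemma weight_nonneg: "0 \<le> weight d n i x"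
  by (simp add: weight_def bump_nonneg sum_nonneg)

lemma sum_weight: "(\<Sum>i\<le>n. weight d n i x) = 1"
  using sum_bump_pos[where d = d and n = n and x = x] by (simp add: weight_def flip: sum_divide_distrib)

lemma weight_le_1: "i \<le> n \<Longrightarrow> weight d n i x \<le> 1"
  using member_le_sum[of i "{..n}" "\<lambda>i. weight d n i x"] by (simp add: sum_weight weight_nonneg)

lemma weight_nonzero_dist:
  "weight d n i x \<noteq> 0 \<Longrightarrow> dist x (d i) < infdist x (d ` {..n}) + 1 / real (Suc n)"
  by (auto simp: weight_def bump_def split: if_splits)

lemma continuous_on_weight: "continuous_on UNIV (weight d n i)"
proof -
  have "continuous_on UNIV (bump d n j)" for j
    unfolding bump_def by (intro continuous_intros)
  then show ?thesis
    using sum_bump_pos[where d = d and n = n] unfolding weight_def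
    by (intro continuous_intros) (auto simp: less_le)
qed

lemma weight_bcontfun: "i \<le> n \<Longrightarrow> weight d n i \<in> bcontfun"
  by (auto simp: bcontfun_def bounded_iff continuous_on_weight weight_le_1 weight_nonneg
      intro!: exI[of _ 1])

text \<open>A centre close to \<open>x\<close> exists by the closure assumption, and it belongs to
  all later initial segments.\<close>

lemma infdist_initial_segments_tendsto:
  assumes "x \<in> closure (range d)"
  shows "(\<lambda>n. infdist x (d ` {..n})) \<longlonglongrightarrow> 0"
proof (rule LIMSEQ_I)
  fix e :: real assume "0 < e"
  then obtain i where i: "dist (d i) x < e"
    using assms by (auto simp: closure_approachable)
  have "infdist x (d ` {..n}) < e" if "n \<ge> i" for n
    using i that infdist_le[of "d i" "d ` {..n}" x] by (auto simp: dist_commute)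
  then show "\<exists>N. \<forall>n\<ge>N. norm (infdist x (d ` {..n}) - 0) < e"
    by (auto simp: infdist_nonneg)
qed

section \<open>Averaging over measures near the centres\<close>

text \<open>The radius depends on the level \<open>n\<close> alone: the indices with nonzero weight
  at a given point change with \<open>n\<close>, so concentration has to be uniform in
  \<open>i\<close>.\<close>

definition concentrated_near ::
    "(nat \<Rightarrow> 'a::metric_space) \<Rightarrow> (nat \<Rightarrow> nat \<Rightarrow> 'a measure) \<Rightarrow> bool" where
  "concentrated_near d \<kappa> \<longleftrightarrow>
    (\<forall>n i. prob_space (\<kappa> n i) \<and> (AE y in \<kappa> n i. dist y (d i) < 1 / real (Suc n)))"

text \<open>Every \<open>\<kappa> n i\<close> with nonzero weight at \<open>x\<close> is carried by
  a small ball around \<open>x\<close>. Continuity of \<open>g\<close> puts its integral close to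
  \<open>g x\<close>, and a convex combination of such integrals is just as close.\<close>

lemma weighted_average_tendsto:
  fixes g :: "'a::metric_space \<Rightarrow> real"
  assumes x: "x \<in> closure (range d)" and \<kappa>: "concentrated_near d \<kappa>"
    and sets: "\<And>n i. sets (\<kappa> n i) = sets borel" and g: "g \<in> bcontfun"
  shows "(\<lambda>n. \<Sum>i\<le>n. weight d n i x * (LINT y|\<kappa> n i. g y)) \<longlonglongrightarrow> g x"
proof (rule LIMSEQ_I)
  fix e :: real assume "0 < e"
  have "isCont g x"
    using g by (simp add: bcontfun_def continuous_on_eq_continuous_at)
  then obtain r where r: "0 < r" "\<And>y. dist y x < r \<Longrightarrow> \<bar>g y - g x\<bar> < e / 2"
    using \<open>0 < e\<close> unfolding continuous_at_eps_delta dist_real_def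
    by (metis half_gt_zero)
  \<comment> \<open>The factor 2 collects two errors: the slack in the weights and the radius of
    concentration of \<open>\<kappa> n i\<close> around \<open>d i\<close>.\<close>
  have "(\<lambda>n. infdist x (d ` {..n}) + 2 * (1 / real (Suc n))) \<longlonglongrightarrow> 0 + 2 * 0"
    by (intro tendsto_intros infdist_initial_segments_tendsto x lim_1_over_n[THEN LIMSEQ_Suc])
  then have "\<forall>\<^sub>F n in sequentially. infdist x (d ` {..n}) + 2 * (1 / real (Suc n)) < r"
    using r(1) by (intro order_tendstoD(2)) auto
  then obtain N where N: "\<And>n. n \<ge> N \<Longrightarrow> infdist x (d ` {..n}) + 2 * (1 / real (Suc n)) < r"
    by (auto simp: eventually_sequentially)
  have "\<bar>(\<Sum>i\<le>n. weight d n i x * (LINT y|\<kappa> n i. g y)) - g x\<bar> < e" if "n \<ge> N" for n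
  proof -
    have near: "\<bar>(LINT y|\<kappa> n i. g y) - g x\<bar> \<le> e / 2" if "weight d n i x \<noteq> 0" for i
    proof -
      interpret prob_space "\<kappa> n i"
        using \<kappa> by (simp add: concentrated_near_def)
      have "AE y in \<kappa> n i. dist y (d i) < 1 / real (Suc n)"
        using \<kappa> by (simp add: concentrated_near_def)
      then have *: "AE y in \<kappa> n i. \<bar>g y - g x\<bar> < e / 2"
      proof eventually_elim
        case (elim y)
        have "dist y x \<le> dist y (d i) + dist x (d i)"
          by (rule dist_triangle2)
        also have "\<dots> < r"
          using elim weight_nonzero_dist[OF that] N[OF \<open>n \<ge> N\<close>] by linarith
        finally show ?case
          by (rule r(2))
      qed
      have "integrable (\<kappa> n i) g"
        using g sets by (elim bcontfun_bounded_borel integrable_bounded_borel[rotated 2]) (auto intro: finite_measure_axioms)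
      moreover have "AE y in \<kappa> n i. g y \<le> g x + e / 2" "AE y in \<kappa> n i. g x - e / 2 \<le> g y"
        using * by (eventually_elim, linarith)+
      ultimately have "(LINT y|\<kappa> n i. g y) \<le> g x + e / 2" "g x - e / 2 \<le> (LINT y|\<kappa> n i. g y)"
        by (auto intro: integral_le_const integral_ge_const)
      then show ?thesis
        by linarith
    qed
    have "(\<Sum>i\<le>n. weight d n i x * (LINT y|\<kappa> n i. g y)) - g x
        = (\<Sum>i\<le>n. weight d n i x * ((LINT y|\<kappa> n i. g y) - g x))"
      by (simp add: right_diff_distrib sum_subtractf sum_weight flip: sum_distrib_right)
    also have "\<bar>\<dots>\<bar> \<le> (\<Sum>i\<le>n. weight d n i x * \<bar>(LINT y|\<kappa> n i. g y) - g x\<bar>)"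
      by (rule order_trans[OF sum_abs]) (simp add: abs_mult weight_nonneg)
    also have "\<dots> \<le> (\<Sum>i\<le>n. weight d n i x * (e / 2))"
      using near by (intro sum_mono) (metis mult_left_mono mult_zero_left order_refl weight_nonneg)
    also have "\<dots> = e / 2"
      by (simp only: sum_distrib_right[symmetric] sum_weight mult_1)
    finally show ?thesis
      using \<open>0 < e\<close> by simp
  qed
  then show "\<exists>N. \<forall>n\<ge>N. norm ((\<Sum>i\<le>n. weight d n i x * (LINT y|\<kappa> n i. g y)) - g x) < e"
    by auto
qed

lemma weighted_average_le:
  fixes g :: "'a::metric_space \<Rightarrow> real"
  assumes \<kappa>: "concentrated_near d \<kappa>" and sets: "\<And>n i. sets (\<kappa> n i) = sets borel"
    and g: "g \<in> borel_measurable borel" "\<And>x. \<bar>g x\<bar> \<le> C"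
  shows "\<bar>\<Sum>i\<le>n. weight d n i x * (LINT y|\<kappa> n i. g y)\<bar> \<le> C"
proof -
  have bound: "\<bar>LINT y|\<kappa> n i. g y\<bar> \<le> C" for i
  proof -
    interpret prob_space "\<kappa> n i"
      using \<kappa> by (simp add: concentrated_near_def)
    have "integrable (\<kappa> n i) g"
      using finite_measure_axioms sets g by (rule integrable_bounded_borel)
    moreover have "- C \<le> g x" "g x \<le> C" for x
      using g(2)[of x] by auto
    ultimately have "- C \<le> (LINT y|\<kappa> n i. g y)" "(LINT y|\<kappa> n i. g y) \<le> C"
      by (auto intro!: integral_le_const integral_ge_const)
    then show ?thesis
      by simp
  qed
  have "\<bar>\<Sum>i\<le>n. weight d n i x * (LINT y|\<kappa> n i. g y)\<bar> \<le> (\<Sum>i\<le>n. weight d n i x * C)"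
    using bound by (intro order_trans[OF sum_abs] sum_mono) (simp add: abs_mult weight_nonneg mult_left_mono)
  also have "\<dots> = C"
    by (simp add: sum_weight flip: sum_distrib_right)
  finally show ?thesis .
qed

section \<open>Convergence of the discretized measures\<close>

lemma linear_combinations_closed_sum:
  fixes M :: "'a signed_measure set" and n :: nat
  assumes "\<And>k l a b. k \<in> M \<Longrightarrow> l \<in> M \<Longrightarrow> (\<lambda>A. a * k A + b * l A) \<in> M"
    and "\<And>i. i \<le> n \<Longrightarrow> \<rho> i \<in> M"
  shows "(\<lambda>A. \<Sum>i\<le>n. c i * \<rho> i A) \<in> M"
  using assms(2)
proof (induction n)
  case 0
  then show ?case
    \<comment> \<open>A single scaled term is a combination of \<open>\<rho> 0\<close> with itself,
      with second coefficient 0.\<close>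
    using assms(1)[of "\<rho> 0" "\<rho> 0" "c 0" 0] by simp
next
  case (Suc n)
  then show ?case
    using assms(1)[of "\<lambda>A. \<Sum>i\<le>n. c i * \<rho> i A" "\<rho> (Suc n)" 1 "c (Suc n)"] by simp
qed

text \<open>
  The conjunct \<open>concentrated_near d \<kappa>\<close> does not mention \<open>x\<close>; under \<open>AE\<close> it is void for null
  measures, where no suitable \<open>\<kappa>\<close> exists in the measurable setting.
\<close>

lemma weak_conv_discretization:
  fixes m1 m2 :: "'a::metric_space measure"
  assumes m1: "finite_measure m1" "sets m1 = sets borel"
    and m2: "finite_measure m2" "sets m2 = sets borel"
    and ae1: "AE x in m1. x \<in> closure (range d) \<and> concentrated_near d \<kappa>"
    and ae2: "AE x in m2. x \<in> closure (range d) \<and> concentrated_near d \<kappa>"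
    and \<kappa>: "\<And>n i. finite_measure (\<kappa> n i)" "\<And>n i. sets (\<kappa> n i) = sets borel"
    and l_eq: "l = (\<lambda>A. measure m1 A - measure m2 A)"
  shows "weak_conv (\<lambda>n A. \<Sum>i\<le>n. pairing (weight d n i) l * measure (\<kappa> n i) A) l"
  unfolding weak_conv_def
proof
  fix g :: "'a \<Rightarrow> real" assume g: "g \<in> bcontfun"
  obtain C where C: "g \<in> borel_measurable borel" "\<And>x. \<bar>g x\<bar> \<le> C"
    using bcontfun_bounded_borel[OF g] by blast
  have l_comb: "l = (\<lambda>A. 1 * measure m1 A + (-1) * measure m2 A)"
    by (simp add: l_eq)
  then have l: "l \<in> finite_signed_measures"
    using m1 m2 by (simp only: linear_combination_signed_measure measure_signed_measure)
  \<comment> \<open>The measures \<open>m1\<close> and \<open>m2\<close> may differ from the Jordan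
    parts of \<open>l\<close>; linearity in the measure still reduces the pairing to their
    integrals.\<close>
  have pairing_l: "pairing f l = (LINT x|m1. f x) - (LINT x|m2. f x)"
    if "f \<in> borel_measurable borel" "\<And>x. \<bar>f x\<bar> \<le> D" for f D
    using pairing_linear_combination[OF measure_signed_measure[OF m1] measure_signed_measure[OF m2] that, of 1 "-1"]
    by (simp add: l_eq pairing_measure m1 m2)
  define a where "a n i = (LINT y|\<kappa> n i. g y)" for n i
  \<comment> \<open>\<open>G n\<close> is the adjoint of the discretization applied to
    \<open>g\<close>: pairing \<open>g\<close> with the discretized measure equals pairing
    \<open>G n\<close> with \<open>l\<close>. This turns convergence of measures into convergence of
    integrands.\<close>
  define G where "G n x = (\<Sum>i\<le>n. weight d n i x * a n i)" for n x
  have w_meas [measurable]: "weight d n i \<in> borel_measurable borel" for n i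
    by (intro borel_measurable_continuous_onI continuous_on_weight)
  have w_bound: "\<bar>a n i * weight d n i x\<bar> \<le> \<bar>a n i\<bar>" if "i \<le> n" for n i x
    using weight_le_1[OF that, of d x] by (simp add: abs_mult weight_nonneg mult_left_le)
  have G_meas [measurable]: "G n \<in> borel_measurable borel" for n
    unfolding G_def by measurable
  \<comment> \<open>This bound depends on \<open>n\<close> and only serves to apply
    \<open>pairing_l\<close>. The uniform bound \<open>C\<close> for dominated convergence holds
    almost everywhere and is established below.\<close>
  have G_bound: "\<bar>G n x\<bar> \<le> (\<Sum>i\<le>n. \<bar>a n i\<bar>)" for n x
    unfolding G_def using w_bound by (intro order_trans[OF sum_abs] sum_mono) (simp add: mult.commute)
  have "pairing g (\<lambda>A. \<Sum>i\<le>n. pairing (weight d n i) l * measure (\<kappa> n i) A) = pairing (G n) l" for n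
  proof -
    have "(\<lambda>A. \<Sum>i\<le>n. pairing (weight d n i) l * measure (\<kappa> n i) A) \<in> finite_signed_measures"
      using \<kappa> by (intro linear_combinations_closed_sum linear_combination_signed_measure measure_signed_measure)
    then have "pairing g (\<lambda>A. \<Sum>i\<le>n. pairing (weight d n i) l * measure (\<kappa> n i) A)
        = (\<Sum>i\<le>n. pairing (weight d n i) l * pairing g (measure (\<kappa> n i)))"
      using \<kappa> C by (intro pairing_sum_signed_measure) (auto intro: measure_signed_measure)
    also have "\<dots> = (\<Sum>i\<le>n. pairing (\<lambda>x. a n i * weight d n i x) l)"
      using \<kappa> by (simp add: pairing_measure pairing_cmult a_def mult.commute)
    also have "\<dots> = pairing (\<lambda>x. \<Sum>i\<le>n. a n i * weight d n i x) l"
      using w_bound by (intro pairing_sum[OF l, symmetric]) auto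
    finally show ?thesis
      by (simp add: G_def [abs_def] mult.commute)
  qed
  moreover have lim: "(\<lambda>n. LINT x|m. G n x) \<longlonglongrightarrow> (LINT x|m. g x)"
    if m: "finite_measure m" "sets m = sets borel"
      and ae: "AE x in m. x \<in> closure (range d) \<and> concentrated_near d \<kappa>" for m
  proof (rule integral_dominated_convergence)
    show "integrable m (\<lambda>_. C)"
      using m(1) by (simp add: finite_measure.integrable_const)
    show "AE x in m. (\<lambda>n. G n x) \<longlonglongrightarrow> g x"
      using ae by eventually_elim (auto simp: G_def a_def intro!: weighted_average_tendsto \<kappa> g)
    show "AE x in m. norm (G n x) \<le> C" for n
      using ae by eventually_elim (auto simp: G_def a_def intro!: weighted_average_le \<kappa> C)
  qed (use C m in \<open>auto cong: measurable_cong_sets\<close>)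
  have "(\<lambda>n. (LINT x|m1. G n x) - (LINT x|m2. G n x)) \<longlonglongrightarrow> (LINT x|m1. g x) - (LINT x|m2. g x)"
    by (intro tendsto_diff lim m1 m2 ae1 ae2)
  ultimately show "(\<lambda>n. pairing g (\<lambda>A. \<Sum>i\<le>n. pairing (weight d n i) l * measure (\<kappa> n i) A)) \<longlonglongrightarrow> pairing g l"
    by (simp add: pairing_l[OF C] pairing_l[OF G_meas G_bound])
qed

section \<open>Approximation by simple transfunctions\<close>

text \<open>With bounded continuous \<open>f i\<close>, the coefficients converge by the very
  definition of weak convergence, and the \<open>\<rho> i\<close> are fixed. The result serves both
  for the approximants and for the inclusion in the continuous setting.\<close>

lemma simple_is_linear_weakly_continuous:
  fixes m :: nat
  assumes M: "M \<subseteq> finite_signed_measures" "\<And>k l a b. k \<in> M \<Longrightarrow> l \<in> M \<Longrightarrow> (\<lambda>A. a * k A + b * l A) \<in> M"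
    and N: "N \<subseteq> finite_signed_measures"
    and \<Phi>: "\<Phi> \<in> M \<rightarrow> N" "\<And>l. l \<in> M \<Longrightarrow> \<Phi> l = (\<lambda>B. \<Sum>i<m. pairing (f i) l * \<rho> i B)"
    and f: "\<And>i. i < m \<Longrightarrow> f i \<in> bcontfun" and \<rho>: "\<And>i. i < m \<Longrightarrow> \<rho> i \<in> N"
  shows "\<Phi> \<in> linear_weakly_continuous_transfunctions M N"
proof -
  have "\<Phi> (\<lambda>A. a * k A + b * l A) = (\<lambda>B. a * \<Phi> k B + b * \<Phi> l B)" if "k \<in> M" "l \<in> M" for k l a b
  proof -
    have "pairing (f i) (\<lambda>A. a * k A + b * l A) = a * pairing (f i) k + b * pairing (f i) l"
      if "i < m" for i
    proof -
      obtain C where "f i \<in> borel_measurable borel" "\<And>x. \<bar>f i x\<bar> \<le> C"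
        using bcontfun_bounded_borel[OF f[OF \<open>i < m\<close>]] by blast
      then show ?thesis
        using M(1) \<open>k \<in> M\<close> \<open>l \<in> M\<close> by (intro pairing_linear_combination) auto
    qed
    then show ?thesis
      using that by (simp add: \<Phi> M(2) distrib_right sum.distrib sum_distrib_left mult.assoc)
  qed
  then have "linear_transfunction M \<Phi>"
    by (simp add: linear_transfunction_def)
  moreover have "weak_conv (\<lambda>n. \<Phi> (ls n)) (\<Phi> l)"
    if ls: "l \<in> M" "\<And>n. ls n \<in> M" "weak_conv ls l" for ls l
    unfolding weak_conv_def
  proof
    fix g :: "'b \<Rightarrow> real" assume "g \<in> bcontfun"
    then obtain C where C: "g \<in> borel_measurable borel" "\<And>x. \<bar>g x\<bar> \<le> C"
      using bcontfun_bounded_borel by blast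
    have pairing_\<Phi>: "pairing g (\<Phi> k) = (\<Sum>i<m. pairing (f i) k * pairing g (\<rho> i))" if "k \<in> M" for k
      using that \<Phi> N \<rho> C by (intro pairing_sum_signed_measure) auto
    have "(\<lambda>n. \<Sum>i<m. pairing (f i) (ls n) * pairing g (\<rho> i)) \<longlonglongrightarrow>
        (\<Sum>i<m. pairing (f i) l * pairing g (\<rho> i))"
      using ls(3) f by (intro tendsto_intros) (auto simp: weak_conv_def)
    then show "(\<lambda>n. pairing g (\<Phi> (ls n))) \<longlonglongrightarrow> pairing g (\<Phi> l)"
      by (simp add: pairing_\<Phi> ls)
  qed
  then have "weakly_continuous M \<Phi>"
    by (simp add: weakly_continuous_def)
  ultimately show ?thesis
    using \<Phi>(1) by (simp add: linear_weakly_continuous_transfunctions_def)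
qed

lemma linear_transfunction_sum:
  fixes M :: "'a signed_measure set" and n :: nat
  assumes M: "\<And>k l a b. k \<in> M \<Longrightarrow> l \<in> M \<Longrightarrow> (\<lambda>A. a * k A + b * l A) \<in> M"
    and \<Phi>: "linear_transfunction M \<Phi>" and \<rho>: "\<And>i. i \<le> n \<Longrightarrow> \<rho> i \<in> M"
  shows "\<Phi> (\<lambda>A. \<Sum>i\<le>n. c i * \<rho> i A) = (\<lambda>B. \<Sum>i\<le>n. c i * \<Phi> (\<rho> i) B)"
proof -
  have lin: "\<Phi> (\<lambda>A. a * k A + b * l A) = (\<lambda>B. a * \<Phi> k B + b * \<Phi> l B)" if "k \<in> M" "l \<in> M" for k l a b
    using \<Phi> that by (simp add: linear_transfunction_def)
  show ?thesis
    using \<rho>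
  proof (induction n)
    case 0
    then show ?case
      using lin[of "\<rho> 0" "\<rho> 0" "c 0" 0] by simp
  next
    case (Suc n)
    have "(\<lambda>A. \<Sum>i\<le>n. c i * \<rho> i A) \<in> M"
      using M Suc.prems by (intro linear_combinations_closed_sum) auto
    then show ?case
      using lin[of "\<lambda>A. \<Sum>i\<le>n. c i * \<rho> i A" "\<rho> (Suc n)" 1 "c (Suc n)"] Suc by simp
  qed
qed

lemma weakly_continuousD:
  "weakly_continuous M \<Phi> \<Longrightarrow> l \<in> M \<Longrightarrow> (\<And>n. ls n \<in> M) \<Longrightarrow> weak_conv ls l
    \<Longrightarrow> weak_conv (\<lambda>n. \<Phi> (ls n)) (\<Phi> l)"
  by (simp add: weakly_continuous_def)

text \<open>This is the argument common to both settings. Linearity moves \<open>\<Phi>\<close> onto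
  the measures \<open>\<kappa> n i\<close>, which makes the composition with the discretization
  simple; weak continuity carries \<open>conv\<close> through \<open>\<Phi>\<close>.\<close>

lemma simple_approximation:
  fixes M :: "'a::metric_space signed_measure set" and N :: "'b::topological_space signed_measure set"
  assumes M: "M \<subseteq> finite_signed_measures" "\<And>k l a b. k \<in> M \<Longrightarrow> l \<in> M \<Longrightarrow> (\<lambda>A. a * k A + b * l A) \<in> M"
    and N: "N \<subseteq> finite_signed_measures" "\<And>k l a b. k \<in> N \<Longrightarrow> l \<in> N \<Longrightarrow> (\<lambda>A. a * k A + b * l A) \<in> N"
    and F: "bcontfun \<subseteq> F" and \<kappa>: "\<And>n i. measure (\<kappa> n i) \<in> M"
    and conv: "\<And>l. l \<in> M \<Longrightarrow>
      weak_conv (\<lambda>n A. \<Sum>i\<le>n. pairing (weight d n i) l * measure (\<kappa> n i) A) l"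
    and \<Phi>: "\<Phi> \<in> linear_weakly_continuous_transfunctions M N"
  shows "\<exists>\<Phi>s. (\<forall>n. \<Phi>s n \<in> simple_transfunctions F M N \<inter> linear_weakly_continuous_transfunctions M N) \<and>
    transfunction_weak_conv M \<Phi>s \<Phi>"
proof -
  have \<Phi>: "\<Phi> \<in> M \<rightarrow> N" "linear_transfunction M \<Phi>" "weakly_continuous M \<Phi>"
    using assms(8) by (auto simp: linear_weakly_continuous_transfunctions_def)
  define \<Phi>s where "\<Phi>s n l = (\<lambda>B. \<Sum>i\<le>n. pairing (weight d n i) l * \<Phi> (measure (\<kappa> n i)) B)" for n l
  have \<Phi>\<kappa>: "\<Phi> (measure (\<kappa> n i)) \<in> N" for n i
    using \<Phi>(1) \<kappa> by auto
  have maps: "\<Phi>s n \<in> M \<rightarrow> N" for n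
    unfolding \<Phi>s_def using N(2) \<Phi>\<kappa> by (intro funcsetI linear_combinations_closed_sum)
  \<comment> \<open>The indices up to \<open>n\<close> give \<open>Suc n\<close> summands, while
    simple transfunctions are indexed by \<open>i < m\<close>.\<close>
  have \<Phi>s_eq: "\<Phi>s n l = (\<lambda>B. \<Sum>i<Suc n. pairing (weight d n i) l * \<Phi> (measure (\<kappa> n i)) B)" for n l
    by (simp add: \<Phi>s_def lessThan_Suc_atMost)
  have "\<Phi>s n \<in> simple_transfunctions F M N" for n
    unfolding simple_transfunctions_def mem_Collect_eq
    using maps[of n] \<Phi>s_eq \<Phi>\<kappa> F weight_bcontfun[of _ n d]
    by (intro conjI exI[of _ "Suc n"] exI[of _ "weight d n"] exI[of _ "\<lambda>i. \<Phi> (measure (\<kappa> n i))"]) auto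
  moreover have "\<Phi>s n \<in> linear_weakly_continuous_transfunctions M N" for n
    using M N(1) maps \<Phi>s_eq by (rule simple_is_linear_weakly_continuous) (auto simp: weight_bcontfun \<Phi>\<kappa>)
  moreover have "weak_conv (\<lambda>n. \<Phi>s n l) (\<Phi> l)" if "l \<in> M" for l
  proof -
    have "(\<lambda>A. \<Sum>i\<le>n. pairing (weight d n i) l * measure (\<kappa> n i) A) \<in> M" for n
      using M(2) \<kappa> by (rule linear_combinations_closed_sum)
    from \<Phi>(3) that this conv[OF that]
    have "weak_conv (\<lambda>n. \<Phi> (\<lambda>A. \<Sum>i\<le>n. pairing (weight d n i) l * measure (\<kappa> n i) A)) (\<Phi> l)"
      by (rule weakly_continuousD)
    moreover have "\<Phi> (\<lambda>A. \<Sum>i\<le>n. pairing (weight d n i) l * measure (\<kappa> n i) A) = \<Phi>s n l" for n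
      unfolding \<Phi>s_def using M(2) \<Phi>(2) \<kappa> by (rule linear_transfunction_sum)
    ultimately show ?thesis
      by simp
  qed
  ultimately show ?thesis
    by (auto simp: transfunction_weak_conv_def)
qed

section \<open>The continuous setting: Dirac measures\<close>

lemma continuous_setting_discretization:
  "\<exists>(d :: nat \<Rightarrow> 'a::{metric_space, second_countable_topology}) \<kappa>.
    (\<forall>n i. measure (\<kappa> n i) \<in> finite_signed_measures) \<and>
    (\<forall>l\<in>finite_signed_measures.
      weak_conv (\<lambda>n A. \<Sum>i\<le>n. pairing (weight d n i) l * measure (\<kappa> n i) A) l)"
proof -
  obtain T :: "'a set" where T: "countable T" "UNIV \<subseteq> closure T"
    using separable[of UNIV] by auto
  define d where "d = from_nat_into T"
  define \<kappa> where "\<kappa> n i = return borel (d i)" for n i :: nat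
  have "T \<noteq> {}"
    using T by auto
  then have dense: "x \<in> closure (range d)" for x
    using T range_from_nat_into by (auto simp: d_def)
  have prob: "prob_space (\<kappa> n i)" for n i
    by (simp add: \<kappa>_def prob_space_return)
  have fin: "finite_measure (\<kappa> n i)" for n i
    using prob by (simp add: prob_space_def)
  have sets: "sets (\<kappa> n i) = sets borel" for n i
    by (simp add: \<kappa>_def)
  \<comment> \<open>The Dirac measure sits at distance 0 from its centre, so it meets every positive
    radius and can be the same for all \<open>n\<close>.\<close>
  have conc: "concentrated_near d \<kappa>"
    using prob unfolding concentrated_near_def \<kappa>_def by (subst AE_return) auto
  show ?thesis
  proof (intro exI[of _ d] exI[of _ \<kappa>] conjI allI ballI)
    show "measure (\<kappa> n i) \<in> finite_signed_measures" for n i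
      using fin sets by (rule measure_signed_measure)
  next
    fix l :: "'a signed_measure" assume l: "l \<in> finite_signed_measures"
    show "weak_conv (\<lambda>n A. \<Sum>i\<le>n. pairing (weight d n i) l * measure (\<kappa> n i) A) l"
      using l Jordan_decomposition[OF l] dense conc fin sets
      by (intro weak_conv_discretization[of "positive_part l" "negative_part l"])
        (auto intro: finite_measure_positive_part finite_measure_negative_part)
  qed
qed

section \<open>A dense sequence in the support of a measure\<close>

text \<open>A point outside the support lies in a null member of a countable base, so the complement
  of the support is null. A countable dense subset of the support then provides the centres, and
  each ball around them has positive measure.\<close>

lemma support_dense_sequence:
  fixes \<mu> :: "'a::{metric_space, second_countable_topology} measure"
  assumes sets: "sets \<mu> = sets borel"
  obtains d :: "nat \<Rightarrow> 'a" where "AE x in \<mu>. x \<in> closure (range d) \<and> (\<forall>i r. 0 < r \<longrightarrow> emeasure \<mu> (ball (d i) r) \<noteq> 0)"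
proof -
  define S where "S = {x. \<forall>r>0. emeasure \<mu> (ball x r) \<noteq> 0}"
  obtain \<B> :: "'a set set" where \<B>: "countable \<B>" "topological_basis \<B>"
    using ex_countable_basis by blast
  define \<N> where "\<N> = {b \<in> \<B>. emeasure \<mu> b = 0}"
  have "b \<in> null_sets \<mu>" if "b \<in> \<N>" for b
    using that topological_basis_open[OF \<B>(2), of b] by (auto simp: \<N>_def null_sets_def sets)
  then have "(\<Union>b\<in>\<N>. b) \<in> null_sets \<mu>"
    using \<B>(1) by (intro null_sets_UN') (auto simp: \<N>_def)
  moreover have "{x \<in> space \<mu>. x \<notin> S} \<subseteq> (\<Union>b\<in>\<N>. b)"
  proof
    fix x assume "x \<in> {x \<in> space \<mu>. x \<notin> S}"
    then obtain r where r: "0 < r" "emeasure \<mu> (ball x r) = 0"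
      by (auto simp: S_def)
    obtain b where b: "b \<in> \<B>" "x \<in> b" "b \<subseteq> ball x r"
      using topological_basisE[OF \<B>(2), of "ball x r" x] r(1) by auto
    have "emeasure \<mu> b \<le> emeasure \<mu> (ball x r)"
      using b sets by (intro emeasure_mono) auto
    then show "x \<in> (\<Union>b\<in>\<N>. b)"
      using b r by (auto simp: \<N>_def)
  qed
  ultimately have AE_S: "AE x in \<mu>. x \<in> S"
    by (rule AE_I')
  obtain T where T: "countable T" "T \<subseteq> S" "S \<subseteq> closure T"
    using separable by blast
  have "AE x in \<mu>. x \<in> closure (range (from_nat_into T)) \<and>
      (\<forall>i r. 0 < r \<longrightarrow> emeasure \<mu> (ball (from_nat_into T i) r) \<noteq> 0)"
    using AE_S
  proof eventually_elim
    case (elim x)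
    \<comment> \<open>Nonemptiness of \<open>T\<close> comes from the point \<open>x\<close> of
      \<open>S\<close>. For the zero measure \<open>S\<close> is empty, which is why the positivity
      of the balls is stated under the almost everywhere quantifier.\<close>
    then have "T \<noteq> {}"
      using T by auto
    then have "range (from_nat_into T) = T"
      using T(1) by simp
    then show ?case
      using elim T by (fastforce simp: S_def)
  qed
  then show thesis
    by (rule that)
qed

section \<open>Measures with essentially bounded density\<close>

context
  fixes \<mu> :: "'a::topological_space measure"
  assumes sets: "sets \<mu> = sets borel" and fin: "finite_measure \<mu>"
begin

lemma integrable_L_infinity:
  assumes "f \<in> L_infinity \<mu>"
  shows "integrable \<mu> f"
proof -
  interpret finite_measure \<mu> by (rule fin)
  obtain C where "f \<in> borel_measurable \<mu>" "AE x in \<mu>. \<bar>f x\<bar> \<le> C"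
    using assms by (auto simp: L_infinity_def)
  then show ?thesis
    by (intro integrable_const_bound[where B = C]) auto
qed

lemma bcontfun_L_infinity: "bcontfun \<subseteq> L_infinity \<mu>"
proof
  fix f :: "'a \<Rightarrow> real" assume "f \<in> bcontfun"
  then obtain C where "f \<in> borel_measurable borel" "\<And>x. \<bar>f x\<bar> \<le> C"
    using bcontfun_bounded_borel by blast
  then show "f \<in> L_infinity \<mu>"
    using sets by (auto simp: L_infinity_def cong: measurable_cong_sets)
qed

lemma linear_combination_L_infinity:
  assumes "f \<in> L_infinity \<mu>" "g \<in> L_infinity \<mu>"
  shows "(\<lambda>x. a * f x + b * g x) \<in> L_infinity \<mu>"
proof -
  obtain C D where CD: "AE x in \<mu>. \<bar>f x\<bar> \<le> C" "AE x in \<mu>. \<bar>g x\<bar> \<le> D"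
    using assms by (auto simp: L_infinity_def)
  then have "AE x in \<mu>. \<bar>a * f x + b * g x\<bar> \<le> \<bar>a\<bar> * C + \<bar>b\<bar> * D"
  proof eventually_elim
    case (elim x)
    have "\<bar>a * f x + b * g x\<bar> \<le> \<bar>a\<bar> * \<bar>f x\<bar> + \<bar>b\<bar> * \<bar>g x\<bar>"
      by (metis abs_mult abs_triangle_ineq)
    also have "\<dots> \<le> \<bar>a\<bar> * C + \<bar>b\<bar> * D"
      using elim by (intro add_mono mult_left_mono) auto
    finally show ?case .
  qed
  then show ?thesis
    using assms by (auto simp: L_infinity_def)
qed

lemma density_signed_linear_combination:
  assumes "f \<in> L_infinity \<mu>" "g \<in> L_infinity \<mu>"
  shows "density_signed \<mu> (\<lambda>x. a * f x + b * g x)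
    = (\<lambda>A. a * density_signed \<mu> f A + b * density_signed \<mu> g A)"
proof
  fix A
  show "density_signed \<mu> (\<lambda>x. a * f x + b * g x) A = a * density_signed \<mu> f A + b * density_signed \<mu> g A"
  proof (cases "A \<in> sets borel")
    case True
    have "set_integrable \<mu> A f" "set_integrable \<mu> A g"
      using True sets assms unfolding set_integrable_def
      by (auto simp del: real_scaleR_def intro!: integrable_mult_indicator[OF _ integrable_L_infinity])
    then show ?thesis
      using True by (simp add: density_signed_def set_integral_add set_integrable_mult_right)
  qed (simp add: density_signed_def)
qed

lemma linear_combination_density_signed:
  assumes "k \<in> density_signed \<mu> ` L_infinity \<mu>" "l \<in> density_signed \<mu> ` L_infinity \<mu>"
  shows "(\<lambda>A. a * k A + b * l A) \<in> density_signed \<mu> ` L_infinity \<mu>"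
  using assms linear_combination_L_infinity density_signed_linear_combination
  by (auto simp flip: density_signed_linear_combination)

text \<open>For nonnegative \<open>h\<close> the set function \<open>density_signed\<close> comes
  from an honest measure, the integral of \<open>h\<close> being finite.\<close>

lemma density_signed_nonneg:
  assumes h: "h \<in> L_infinity \<mu>" "\<And>x. 0 \<le> h x"
  shows "finite_measure (density \<mu> (\<lambda>x. ennreal (h x)))"
    and "measure (density \<mu> (\<lambda>x. ennreal (h x))) = density_signed \<mu> h"
proof -
  have meas [measurable]: "h \<in> borel_measurable \<mu>"
    using h by (simp add: L_infinity_def)
  have em: "emeasure (density \<mu> (\<lambda>x. ennreal (h x))) A = ennreal (density_signed \<mu> h A)"
    if A: "A \<in> sets borel" for A
  proof -
    have [measurable]: "A \<in> sets \<mu>"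
      using A sets by simp
    have int: "integrable \<mu> (\<lambda>x. indicator A x * h x)"
      using integrable_mult_indicator[OF _ integrable_L_infinity[OF h(1)], of A] by simp
    have "emeasure (density \<mu> (\<lambda>x. ennreal (h x))) A = (\<integral>\<^sup>+x. ennreal (indicator A x * h x) \<partial>\<mu>)"
      by (subst emeasure_density) (auto intro!: nn_integral_cong split: split_indicator)
    also have "\<dots> = ennreal (density_signed \<mu> h A)"
      using A int h(2) by (subst nn_integral_eq_integral) (auto simp: density_signed_def set_lebesgue_integral_def)
    finally show ?thesis .
  qed
  show "finite_measure (density \<mu> (\<lambda>x. ennreal (h x)))"
    using em[of "space \<mu>"] sets by (intro finite_measureI) (auto simp: sets_eq_imp_space_eq[OF sets])
  show "measure (density \<mu> (\<lambda>x. ennreal (h x))) = density_signed \<mu> h"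
  proof
    fix A show "measure (density \<mu> (\<lambda>x. ennreal (h x))) A = density_signed \<mu> h A"
    proof (cases "A \<in> sets borel")
      case True
      have "0 \<le> density_signed \<mu> h A"
        using h(2) by (auto simp: density_signed_def set_lebesgue_integral_def intro!: integral_nonneg)
      then show ?thesis
        using em[OF True] by (simp add: measure_def)
    qed (auto simp: density_signed_def measure_notin_sets sets)
  qed
qed

text \<open>Splitting \<open>h\<close> into positive and negative part yields a difference of two
  finite measures, the form in which \<open>weak_conv_discretization\<close> takes its signed
  measure.\<close>

lemma density_signed_Jordan:
  assumes h: "h \<in> L_infinity \<mu>"
  shows "(\<lambda>x. max 0 (h x)) \<in> L_infinity \<mu>" "(\<lambda>x. max 0 (- h x)) \<in> L_infinity \<mu>"
    and "density_signed \<mu> h = (\<lambda>A. measure (density \<mu> (\<lambda>x. ennreal (max 0 (h x)))) A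
      - measure (density \<mu> (\<lambda>x. ennreal (max 0 (- h x)))) A)"
proof -
  have [measurable]: "h \<in> borel_measurable \<mu>"
    using h by (simp add: L_infinity_def)
  obtain C where C: "AE x in \<mu>. \<bar>h x\<bar> \<le> C"
    using h by (auto simp: L_infinity_def)
  then have "AE x in \<mu>. \<bar>max 0 (h x)\<bar> \<le> C" "AE x in \<mu>. \<bar>max 0 (- h x)\<bar> \<le> C"
    by (auto elim!: eventually_mono)
  then show pos: "(\<lambda>x. max 0 (h x)) \<in> L_infinity \<mu>" and neg: "(\<lambda>x. max 0 (- h x)) \<in> L_infinity \<mu>"
    by (auto simp: L_infinity_def)
  have "(\<lambda>x. 1 * max 0 (h x) + (-1) * max 0 (- h x)) = h"
    by auto
  with density_signed_linear_combination[OF pos neg, of 1 "-1"]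
  show "density_signed \<mu> h = (\<lambda>A. measure (density \<mu> (\<lambda>x. ennreal (max 0 (h x)))) A
      - measure (density \<mu> (\<lambda>x. ennreal (max 0 (- h x)))) A)"
    by (simp add: density_signed_nonneg(2) pos neg)
qed

lemma density_signed_signed_measure:
  "density_signed \<mu> ` L_infinity \<mu> \<subseteq> finite_signed_measures"
proof clarify
  fix h assume h: "h \<in> L_infinity \<mu>"
  let ?P = "density \<mu> (\<lambda>x. ennreal (max 0 (h x)))" and ?N = "density \<mu> (\<lambda>x. ennreal (max 0 (- h x)))"
  have "measure ?P \<in> finite_signed_measures" "measure ?N \<in> finite_signed_measures"
    using measure_signed_measure[OF density_signed_nonneg(1)[OF density_signed_Jordan(1)[OF h]]]
      measure_signed_measure[OF density_signed_nonneg(1)[OF density_signed_Jordan(2)[OF h]]]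
    by (simp_all add: sets)
  from linear_combination_signed_measure[OF this, of 1 "-1"]
  show "density_signed \<mu> h \<in> finite_signed_measures"
    by (simp add: density_signed_Jordan(3)[OF h])
qed

end

section \<open>The measurable setting: normalised restrictions to balls\<close>

lemma measurable_setting_discretization:
  fixes \<mu> :: "'a::{metric_space, second_countable_topology} measure"
  assumes sets: "sets \<mu> = sets borel" and fin: "finite_measure \<mu>"
  shows "\<exists>d \<kappa>. (\<forall>n i. measure (\<kappa> n i) \<in> density_signed \<mu> ` L_infinity \<mu>) \<and>
    (\<forall>l\<in>density_signed \<mu> ` L_infinity \<mu>.
      weak_conv (\<lambda>n A. \<Sum>i\<le>n. pairing (weight d n i) l * measure (\<kappa> n i) A) l)"
proof -
  interpret finite_measure \<mu> by (rule fin)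
  obtain d :: "nat \<Rightarrow> 'a" where
    d: "AE x in \<mu>. x \<in> closure (range d) \<and> (\<forall>i r. 0 < r \<longrightarrow> emeasure \<mu> (ball (d i) r) \<noteq> 0)"
    using support_dense_sequence[OF sets] by blast
  define B where "B n i = ball (d i) (1 / real (Suc n))" for n i
  \<comment> \<open>The density of the normalised restriction of \<open>\<mu>\<close> to
    \<open>B n i\<close>. On a null ball division by 0 gives \<open>h n i = 0\<close>, so
    \<open>\<kappa> n i\<close> is the zero measure and still has a bounded density.\<close>
  define h where "h n i x = indicator (B n i) x / measure \<mu> (B n i)" for n i x
  define \<kappa> where "\<kappa> n i = density \<mu> (\<lambda>x. ennreal (h n i x))" for n i
  have B [measurable]: "B n i \<in> sets \<mu>" for n i
    by (simp add: B_def sets)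
  have h_meas [measurable]: "h n i \<in> borel_measurable \<mu>" for n i
    unfolding h_def by measurable
  have h_L: "h n i \<in> L_infinity \<mu>" for n i
    using h_meas[of n i] unfolding L_infinity_def h_def
    by (auto intro!: exI[of _ "1 / measure \<mu> (B n i)"] split: split_indicator)
  have h_nonneg: "0 \<le> h n i x" for n i x
    by (simp add: h_def)
  note \<kappa> = density_signed_nonneg[OF sets fin h_L h_nonneg, folded \<kappa>_def]
  have sets_\<kappa>: "sets (\<kappa> n i) = sets borel" for n i
    by (simp add: \<kappa>_def sets)
  have space_\<kappa>: "space (\<kappa> n i) = space \<mu>" for n i
    by (simp add: \<kappa>_def)
  have near: "concentrated_near d \<kappa>" if pos: "\<forall>i r. 0 < r \<longrightarrow> emeasure \<mu> (ball (d i) r) \<noteq> 0"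
    unfolding concentrated_near_def
  proof (intro allI conjI)
    fix n i
    interpret \<kappa>: finite_measure "\<kappa> n i"
      by (rule \<kappa>(1))
    have "measure \<mu> (B n i) \<noteq> 0"
      using pos by (auto simp: B_def measure_eq_emeasure_eq_ennreal emeasure_eq_measure)
    moreover have "measure (\<kappa> n i) (space \<mu>) = measure \<mu> (B n i) / measure \<mu> (B n i)"
      using sets sets.sets_into_space[OF B, of n i]
      by (simp add: \<kappa>(2) density_signed_def h_def set_lebesgue_integral_def sets_eq_imp_space_eq[OF sets])
    ultimately show "prob_space (\<kappa> n i)"
      by (intro prob_spaceI) (simp add: \<kappa>.emeasure_eq_measure space_\<kappa>)
    show "AE y in \<kappa> n i. dist y (d i) < 1 / real (Suc n)"
      unfolding \<kappa>_def
      by (subst AE_density, measurable) (auto simp: h_def B_def dist_commute split: split_indicator)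
  qed
  show ?thesis
  proof (intro exI[of _ d] exI[of _ \<kappa>] conjI allI ballI)
    show "measure (\<kappa> n i) \<in> density_signed \<mu> ` L_infinity \<mu>" for n i
      using \<kappa>(2) h_L by auto
  next
    fix l assume "l \<in> density_signed \<mu> ` L_infinity \<mu>"
    then obtain f where f: "f \<in> L_infinity \<mu>" "l = density_signed \<mu> f"
      by auto
    let ?P = "density \<mu> (\<lambda>x. ennreal (max 0 (f x)))" and ?N = "density \<mu> (\<lambda>x. ennreal (max 0 (- f x)))"
    note J = density_signed_Jordan[OF sets fin f(1)]
    have [measurable]: "f \<in> borel_measurable \<mu>"
      using f(1) by (simp add: L_infinity_def)
    \<comment> \<open>Almost everywhere statements pass from \<open>\<mu>\<close> to its densities.
      The positivity clause in \<open>d\<close> does not depend on \<open>x\<close>, so one good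
      point yields \<open>concentrated_near d \<kappa>\<close>.\<close>
    have ae: "AE x in density \<mu> g. x \<in> closure (range d) \<and> concentrated_near d \<kappa>"
      if "g \<in> borel_measurable \<mu>" for g
      unfolding AE_density[OF that] using d by eventually_elim (blast intro: near)
    show "weak_conv (\<lambda>n A. \<Sum>i\<le>n. pairing (weight d n i) l * measure (\<kappa> n i) A) l"
    proof (rule weak_conv_discretization[of ?P ?N])
      show "finite_measure ?P" "finite_measure ?N"
        using density_signed_nonneg(1)[OF sets fin J(1)] density_signed_nonneg(1)[OF sets fin J(2)] by auto
      show "AE x in ?P. x \<in> closure (range d) \<and> concentrated_near d \<kappa>"
        "AE x in ?N. x \<in> closure (range d) \<and> concentrated_near d \<kappa>"
        by (intro ae, measurable)+
      show "l = (\<lambda>A. measure ?P A - measure ?N A)"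
        using f(2) J(3) by simp
    qed (use sets \<kappa>(1) sets_\<kappa> in auto)
  qed
qed

text \<open>The approximants are asked to be both simple and weakly continuous. In the measurable
  setting the coefficients may be discontinuous, and weak convergence does not control their
  pairings, so the inclusion of all simple transfunctions is claimed for the continuous
  setting.\<close>

theorem theorem7p2:
  fixes FX :: "('a::polish_space \<Rightarrow> real) set" and MX :: "'a signed_measure set"
    and FY :: "('b::polish_space \<Rightarrow> real) set" and MY :: "'b signed_measure set"
  assumes "locally_compact_space (euclidean :: 'a topology)"
    and "locally_compact_space (euclidean :: 'b topology)"
    and "(continuous_setting FX MX \<and> continuous_setting FY MY) \<or>
         (measurable_setting FX MX \<and> measurable_setting FY MY)"
  shows "(\<forall>\<Phi> \<in> linear_weakly_continuous_transfunctions MX MY.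
            \<exists>\<Phi>s. (\<forall>n. \<Phi>s n \<in> simple_transfunctions FX MX MY
                              \<inter> linear_weakly_continuous_transfunctions MX MY) \<and>
                  transfunction_weak_conv MX \<Phi>s \<Phi>)
       \<and> (continuous_setting FX MX \<and> continuous_setting FY MY \<longrightarrow>
            simple_transfunctions FX MX MY \<subseteq> linear_weakly_continuous_transfunctions MX MY)"
proof (intro conjI ballI impI subsetI)
  fix \<Phi> assume \<Phi>: "\<Phi> \<in> linear_weakly_continuous_transfunctions MX MY"
  show "\<exists>\<Phi>s. (\<forall>n. \<Phi>s n \<in> simple_transfunctions FX MX MY
                              \<inter> linear_weakly_continuous_transfunctions MX MY) \<and>
                  transfunction_weak_conv MX \<Phi>s \<Phi>"
    using assms(3)
  proof
    assume "continuous_setting FX MX \<and> continuous_setting FY MY"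
    then have eqs: "FX = bcontfun" "MX = finite_signed_measures" "MY = finite_signed_measures"
      by (auto simp: continuous_setting_def)
    obtain d \<kappa> where "\<forall>n i. measure (\<kappa> n i) \<in> MX"
      and "\<forall>l\<in>MX. weak_conv (\<lambda>n A. \<Sum>i\<le>n. pairing (weight d n i) l * measure (\<kappa> n i) A) l"
      using continuous_setting_discretization[where ?'a = 'a] unfolding eqs by blast
    note d\<kappa> = this[rule_format]
    show ?thesis
      by (rule simple_approximation[OF _ _ _ _ _ d\<kappa> \<Phi>])
        (simp_all add: eqs linear_combination_signed_measure)
  next
    assume "measurable_setting FX MX \<and> measurable_setting FY MY"
    then obtain \<mu> \<nu> where \<mu>: "sets \<mu> = sets borel" "finite_measure \<mu>"
      and \<nu>: "sets \<nu> = sets borel" "finite_measure \<nu>"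
      and eqs: "FX = L_infinity \<mu>" "MX = density_signed \<mu> ` L_infinity \<mu>"
        "MY = density_signed \<nu> ` L_infinity \<nu>"
      by (auto simp: measurable_setting_def)
    obtain d \<kappa> where "\<forall>n i. measure (\<kappa> n i) \<in> MX"
      and "\<forall>l\<in>MX. weak_conv (\<lambda>n A. \<Sum>i\<le>n. pairing (weight d n i) l * measure (\<kappa> n i) A) l"
      using measurable_setting_discretization[OF \<mu>] unfolding eqs by blast
    note d\<kappa> = this[rule_format]
    show ?thesis
    proof (rule simple_approximation[OF _ _ _ _ _ d\<kappa> \<Phi>])
      show "MX \<subseteq> finite_signed_measures" "MY \<subseteq> finite_signed_measures"
        using density_signed_signed_measure \<mu> \<nu> by (auto simp: eqs)
      show "bcontfun \<subseteq> FX"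
        using bcontfun_L_infinity \<mu> by (simp add: eqs)
      show "(\<lambda>A. a * k A + b * l A) \<in> MX" if "k \<in> MX" "l \<in> MX" for k l a b
        using linear_combination_density_signed[OF \<mu>] that by (simp add: eqs)
      show "(\<lambda>A. a * k A + b * l A) \<in> MY" if "k \<in> MY" "l \<in> MY" for k l a b
        using linear_combination_density_signed[OF \<nu>] that by (simp add: eqs)
    qed
  qed
next
  fix \<Phi>
  assume "continuous_setting FX MX \<and> continuous_setting FY MY"
    and \<Phi>: "\<Phi> \<in> simple_transfunctions FX MX MY"
  then have eqs: "FX = bcontfun" "MX = finite_signed_measures" "MY = finite_signed_measures"
    by (auto simp: continuous_setting_def)
  from \<Phi> obtain m :: nat and f \<rho> where "\<Phi> \<in> MX \<rightarrow> MY" "\<forall>i<m. f i \<in> FX \<and> \<rho> i \<in> MY"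
    and "\<forall>l\<in>MX. \<Phi> l = (\<lambda>B. \<Sum>i<m. pairing (f i) l * \<rho> i B)"
    unfolding simple_transfunctions_def by blast
  then show "\<Phi> \<in> linear_weakly_continuous_transfunctions MX MY"
    by (intro simple_is_linear_weakly_continuous[where m = m and f = f and \<rho> = \<rho>])
      (auto simp: eqs intro: linear_combination_signed_measure)
qed

end
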